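(* Let $\mathbb{F}_q$ have prime characteristic $p$. Then: (i) $P(1,\mathbb{F}_q)=D(q-1)$. (ii) $P(2,\mathbb{F}_q)=D(q^2-1)\cup pD(q-1)$. (iii) $P(3,\mathbb{F}_q)=D(q^3-1)\cup D(q^2-1)\cup pD(q-1)$ if $p\ge3$, and $P(3,\mathbb{F}_q)=D(q^3-1)\cup D(q^2-1)\cup \{2,4\}D(q-1)$ if $p=2$. (iv) $P(4,\mathbb{F}_q)=D(q^4-1)\cup D(q^3-1)\cup pD(q^2-1)$ if $p\ge5$, and $P(4,\mathbb{F}_q)=D(q^4-1)\cup D(q^3-1)\cup pD(q^2-1)\cup p^2D(q-1)$ if $p\in\{2,3\}$. Equivalently, for $1\le k\le 4$ one has $P(k,\mathbb{F}_q)=\bigcup_{i=1}^k \{p^j : 0\le j\le t_i\}\,D(q^i-1)$ with $t_i=\min\{t\in\mathbb{Z}: p^t\ge\lfloor k/i\rfloor\}$.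
   Context: A sequence $(a_n)_{n\ge0}$ over $\mathbb{F}_q$ satisfies a linear recurrence of degree $k$ if there are $c_0,\dots,c_{k-1}\in\mathbb{F}_q$, with $c_0\neq0$ (standing assumption), such that $a_{n+k}=\sum_{i=0}^{k-1}c_ia_{n+i}$ for all $n\ge0$; such sequences are purely periodic and $\rho(\mathbf{a})$ is the least $m>0$ with $a_{n+m}=a_n$ for all $n\ge0$. $P(k,\mathbb{F}_q)$ is the set of all $\rho(\mathbf{a})$ for sequences $\mathbf{a}$ satisfying some linear recurrence of degree $k$ over $\mathbb{F}_q$. For $n\in\mathbb{Z}_{>0}$, $D(n)$ is the set of positive divisors of $n$. For sets $S_1,S_2\subseteq\mathbb{Z}$ and $a\in\mathbb{Z}$, $aS_1=\{ax: x\in S_1\}$ and $S_1S_2=\{xy : x\in S_1, y\in S_2\}$. *)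

theory Defs
  imports Main
begin

definition lin_rec :: "nat \<Rightarrow> (nat \<Rightarrow> 'a::field) \<Rightarrow> bool" where
  "lin_rec k a \<longleftrightarrow>
     (\<exists>c :: nat \<Rightarrow> 'a. c 0 \<noteq> 0 \<and> (\<forall>n. a (n + k) = (\<Sum>i<k. c i * a (n + i))))"

text \<open>least period (sequences considered are purely periodic)\<close>
definition period :: "(nat \<Rightarrow> 'a) \<Rightarrow> nat" where
  "period a = (LEAST m. 0 < m \<and> (\<forall>n. a (n + m) = a n))"

definition Pset :: "nat \<Rightarrow> 'a::field itself \<Rightarrow> nat set" where
  "Pset k t = {period a | a :: nat \<Rightarrow> 'a. lin_rec k a}"

definition D :: "nat \<Rightarrow> nat set" where
  "D n = {d. 0 < d \<and> d dvd n}"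

definition smul :: "nat \<Rightarrow> nat set \<Rightarrow> nat set" where
  "smul c S = (\<lambda>x. c * x) ` S"

definition setmul :: "nat set \<Rightarrow> nat set \<Rightarrow> nat set" where
  "setmul A B = {x * y | x y. x \<in> A \<and> y \<in> B}"

end

theory Submission
  imports Defs "HOL-Algebra.Algebraic_Closure_Type" "HOL-Algebra.Multiplicative_Group"
    "HOL-Library.Cardinality"
begin

text \<open>
  A sequence annihilated by a polynomial \<open>f\<close> in the shift has period dividing \<open>N\<close> as soon as
  \<open>f\<close> divides \<open>X\<^sup>N - 1\<close>, and some sequence has period exactly the order of \<open>f\<close>. So the periods
  are the orders of the polynomials \<open>f\<close> of degree at most \<open>k\<close> with \<open>f(0) \<noteq> 0\<close>.

  Upper bound: a root of \<open>f\<close> in the algebraic closure whose minimal polynomial has degree \<open>m\<close>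
  satisfies \<open>x\<^bsup>q^m - 1\<^esup> = 1\<close>, and multiplicities up to \<open>p\<^sup>t\<close> are absorbed by
  \<open>(X\<^sup>M - 1)\<^bsup>p^t\<^esup> = X\<^bsup>M p^t\<^esup> - 1\<close>; for \<open>k \<le> 4\<close> only few factorization patterns occur.

  Lower bound: for \<open>d\<close> dividing \<open>q\<^sup>i - 1\<close> let \<open>g\<close> be the minimal polynomial of an element of
  order \<open>d\<close> in the field with \<open>q\<^sup>i\<close> elements. If \<open>p\<^bsup>j-1\<^esup> < r \<le> p\<^sup>j\<close>, then \<open>g\<^sup>r\<close> has order \<open>p\<^sup>j d\<close>,
  because the roots of \<open>X\<^sup>M - 1\<close> are simple when \<open>p\<close> does not divide \<open>M\<close>.
\<close>

section \<open>Linear recurrences and polynomials in the shift\<close>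

text \<open>Sequences become a module over the polynomial ring, with \<open>X\<close> acting as the
  shift; a recurrence says that a monic polynomial annihilates the sequence.\<close>

definition rec_op :: "'a::comm_ring_1 poly \<Rightarrow> (nat \<Rightarrow> 'a) \<Rightarrow> nat \<Rightarrow> 'a" where
  "rec_op f a n = (\<Sum>i\<le>degree f. coeff f i * a (n + i))"

abbreviation unity_poly :: "nat \<Rightarrow> 'a::comm_ring_1 poly" where
  "unity_poly N \<equiv> monom 1 N - 1"

lemma rec_op_eq_sum: "degree f \<le> m \<Longrightarrow> rec_op f a n = (\<Sum>i\<le>m. coeff f i * a (n + i))"
  unfolding rec_op_def by (rule sum.mono_neutral_left) (auto simp: coeff_eq_0)

lemma rec_op_0 [simp]: "rec_op 0 a n = 0"
  by (simp add: rec_op_def)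

lemma rec_op_add: "rec_op (f + g) a n = rec_op f a n + rec_op g a n"
proof -
  let ?m = "max (degree f) (degree g)"
  have "rec_op (f + g) a n = (\<Sum>i\<le>?m. coeff (f + g) i * a (n + i))"
    by (rule rec_op_eq_sum) (rule degree_add_le_max)
  then show ?thesis
    by (simp add: rec_op_eq_sum[of f ?m] rec_op_eq_sum[of g ?m] algebra_simps sum.distrib)
qed

lemma rec_op_smult: "rec_op (smult c f) a n = c * rec_op f a n"
proof -
  have "rec_op (smult c f) a n = (\<Sum>i\<le>degree f. coeff (smult c f) i * a (n + i))"
    by (rule rec_op_eq_sum) (rule degree_smult_le)
  then show ?thesis by (simp add: rec_op_def sum_distrib_left mult.assoc)
qed

lemma rec_op_diff: "rec_op (f - g) a n = rec_op f a n - rec_op g a n"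
  using rec_op_add[of f "smult (-1) g" a n] rec_op_smult[of "-1" g a n] by simp

lemma rec_op_pCons: "rec_op (pCons c f) a n = c * a n + rec_op f a (Suc n)"
proof -
  have "rec_op (pCons c f) a n = (\<Sum>i\<le>Suc (degree f). coeff (pCons c f) i * a (n + i))"
    by (rule rec_op_eq_sum) (rule degree_pCons_le)
  then show ?thesis by (simp only: sum.atMost_Suc_shift) (simp add: rec_op_def)
qed

lemma rec_op_monom: "rec_op (monom c m) a n = c * a (n + m)"
  by (induction m arbitrary: n) (simp_all add: monom_0 monom_Suc rec_op_pCons)

lemma rec_op_unity_poly: "rec_op (unity_poly N) a n = a (n + N) - a n"
  using rec_op_monom[of 1 0 a n] by (simp add: rec_op_diff rec_op_monom)

text \<open>The annihilator of a sequence is an ideal. The induction peels off coefficients of the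
  multiplier, with \<open>n\<close> generalised because \<open>X\<close> moves the index.\<close>

lemma rec_op_dvd:
  assumes "f dvd h" "\<And>n. rec_op f a n = 0"
  shows "rec_op h a n = 0"
proof -
  have "rec_op (g * f) a n = 0" for g
    by (induction g arbitrary: n)
      (simp_all add: rec_op_add rec_op_smult rec_op_pCons assms(2))
  with assms(1) show ?thesis by (auto simp: mult.commute elim!: dvdE)
qed

text \<open>With all terms on one side, \<open>c i\<close> becomes \<open>- coeff f i\<close>, and
  \<open>c 0 \<noteq> 0\<close> becomes a nonzero constant term.\<close>

lemma lin_rec_iff_rec_op:
  fixes a :: "nat \<Rightarrow> 'a::field"
  assumes "k > 0"
  shows "lin_rec k a \<longleftrightarrow>
    (\<exists>f. degree f = k \<and> lead_coeff f = 1 \<and> coeff f 0 \<noteq> 0 \<and> (\<forall>n. rec_op f a n = 0))"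
    (is "_ \<longleftrightarrow> ?R")
proof
  assume "lin_rec k a"
  then obtain c where c: "c 0 \<noteq> 0" "\<And>n. a (n + k) = (\<Sum>i<k. c i * a (n + i))"
    by (auto simp: lin_rec_def)
  define f where "f = monom 1 k - (\<Sum>i<k. monom (c i) i)"
  have coeff: "coeff f j = (if j = k then 1 else if j < k then - c j else 0)" for j
    by (auto simp: f_def coeff_sum)
  have "degree f \<le> k" by (rule degree_le) (simp add: coeff)
  moreover have "k \<le> degree f" by (rule le_degree) (simp add: coeff)
  ultimately have deg: "degree f = k" by simp
  have "rec_op f a n = 0" for n
    using c(2)[of n] by (simp add: rec_op_def deg coeff lessThan_Suc_atMost[symmetric] sum_negf)
  then show ?R using deg c(1) assms by (intro exI[of _ f]) (auto simp: coeff)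
next
  assume ?R
  then obtain f where f: "degree f = k" "lead_coeff f = 1" "coeff f 0 \<noteq> 0"
    "\<And>n. rec_op f a n = 0" by auto
  have "a (n + k) = (\<Sum>i<k. - coeff f i * a (n + i))" for n
    using f(4)[of n] f(1,2)
    by (simp add: rec_op_def lessThan_Suc_atMost[symmetric] sum_negf add_eq_0_iff)
  then show "lin_rec k a" unfolding lin_rec_def
    using f(3) by (intro exI[of _ "\<lambda>i. - coeff f i"]) simp
qed

lemma lin_rec_mono:
  fixes a :: "nat \<Rightarrow> 'a::field"
  assumes "lin_rec m a" "m \<le> k" "m > 0"
  shows "lin_rec k a"
proof -
  obtain f where f: "degree f = m" "lead_coeff f = 1" "coeff f 0 \<noteq> 0" "\<And>n. rec_op f a n = 0"
    using assms lin_rec_iff_rec_op by blast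
  \<comment> \<open>Powers of \<open>X - 1\<close> raise the degree to \<open>k\<close> and keep the
    polynomial monic; powers of \<open>X\<close> would destroy the nonzero constant term.\<close>
  define g where "g = [:-1, 1:] ^ (k - m) * f"
  have "degree g = k" using f(1) assms(2,3)
    by (subst g_def, subst degree_mult_eq) (auto simp: degree_linear_power)
  moreover have "lead_coeff g = 1" unfolding g_def lead_coeff_mult f(2)
    by (simp add: lead_coeff_power)
  moreover have "coeff g 0 \<noteq> 0" using f(3) by (simp add: g_def coeff_mult_0 coeff_0_power)
  moreover have "rec_op g a n = 0" for n
    by (rule rec_op_dvd[of f]) (auto simp: g_def f(4))
  ultimately show ?thesis using lin_rec_iff_rec_op[of k a] assms by auto
qed

section \<open>Least periods and a sequence realising the order of a polynomial\<close>

lemma period_props: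
  fixes a :: "nat \<Rightarrow> 'a"
  assumes "N > 0" "\<And>n. a (n + N) = a n"
  shows period_pos: "period a > 0"
    and period_dvd_iff: "(\<forall>n. a (n + M) = a n) \<longleftrightarrow> period a dvd M"
proof -
  let ?P = "\<lambda>m. 0 < m \<and> (\<forall>n. a (n + m) = a n)"
  have P: "?P (period a)" unfolding period_def by (rule LeastI[of ?P N]) (use assms in auto)
  then show "period a > 0" by simp
  have mult: "a (n + m * period a) = a n" for n m
  proof (induction m)
    case (Suc m)
    have "a (n + Suc m * period a) = a ((n + m * period a) + period a)" by (simp add: ac_simps)
    with P Suc show ?case by simp
  qed simp
  show "(\<forall>n. a (n + M) = a n) \<longleftrightarrow> period a dvd M"
  proof
    assume M: "\<forall>n. a (n + M) = a n"
    \<comment> \<open>The remainder also shifts \<open>a\<close> to itself and lies below the least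
      positive such number, hence is 0.\<close>
    have "a (n + M mod period a) = a n" for n
    proof -
      have "a (n + M mod period a) = a (n + M mod period a + (M div period a) * period a)"
        by (rule mult[symmetric])
      also have "\<dots> = a (n + M)" by (metis add.assoc mod_div_mult_eq)
      finally show ?thesis using M by simp
    qed
    moreover have "M mod period a < period a" using P by simp
    ultimately have "M mod period a = 0"
      using not_less_Least[of "M mod period a" ?P] unfolding period_def[symmetric] by auto
    then show "period a dvd M" by auto
  next
    assume "period a dvd M"
    then show "\<forall>n. a (n + M) = a n" using mult by (auto simp: mult.commute elim!: dvdE)
  qed
qed

lemma period_in_D:
  fixes a :: "nat \<Rightarrow> 'a::field"
  assumes "\<And>n. rec_op f a n = 0" "f dvd unity_poly N" "N > 0"
  shows "period a \<in> D N"
proof -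
  have "a (n + N) = a n" for n
    using rec_op_dvd[OF assms(2,1), of n] by (simp add: rec_op_unity_poly)
  with period_props[of N a] \<open>N > 0\<close> show ?thesis by (auto simp: D_def)
qed

text \<open>The top-coefficient functional on residues modulo \<open>f\<close> vanishes on no
  nonzero ideal: a nonzero residue times a suitable power of \<open>X\<close> has degree exactly
  \<open>degree f - 1\<close>, so no reduction takes place.\<close>

lemma coeff_shift_mod_zero_iff:
  fixes f h :: "'a::field poly"
  assumes "degree f > 0"
  shows "(\<forall>n. coeff ((monom 1 n * h) mod f) (degree f - 1) = 0) \<longleftrightarrow> f dvd h"
proof
  assume *: "\<forall>n. coeff ((monom 1 n * h) mod f) (degree f - 1) = 0"
  show "f dvd h"
  proof (rule ccontr)
    assume "\<not> f dvd h"
    define r where "r = h mod f"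
    have r: "r \<noteq> 0" using \<open>\<not> f dvd h\<close> by (simp add: r_def dvd_eq_mod_eq_0)
    have dr: "degree r < degree f"
      using r assms degree_mod_less'[of f h] by (force simp: r_def)
    define n where "n = degree f - 1 - degree r"
    have d: "degree (monom 1 n * r) = degree f - 1"
      using r dr by (simp add: degree_mult_eq degree_monom_eq n_def)
    have "(monom 1 n * h) mod f = (monom 1 n * r) mod f"
      by (simp add: r_def mod_mult_right_eq)
    also have "\<dots> = monom 1 n * r"
      by (rule mod_poly_less) (use d assms in simp)
    finally have "coeff (monom 1 n * r) (degree f - 1) = 0" using *[rule_format, of n] by simp
    then have "lead_coeff (monom 1 n * r) = 0" using d by simp
    then show False using r by simp
  qed
next
  assume "f dvd h"
  then have "(monom 1 n * h) mod f = 0" for n by (simp add: mod_eq_0_iff_dvd)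
  then show "\<forall>n. coeff ((monom 1 n * h) mod f) (degree f - 1) = 0" by simp
qed

text \<open>The witness is \<open>n \<mapsto> \<lambda>(X\<^sup>n mod f)\<close> with \<open>\<lambda>\<close> the top-coefficient functional: a polynomial
  annihilates this sequence iff it is a multiple of \<open>f\<close>.\<close>
lemma order_in_Pset:
  fixes f :: "'a::field poly"
  assumes f: "degree f > 0" "degree f \<le> k" "lead_coeff f = 1" "coeff f 0 \<noteq> 0"
    and T: "T > 0" "\<And>N. N > 0 \<Longrightarrow> f dvd unity_poly N \<longleftrightarrow> T dvd N"
  shows "T \<in> Pset k TYPE('a)"
proof -
  define s where "s n = coeff (monom 1 n mod f) (degree f - 1)" for n
  \<comment> \<open>Letting \<open>h\<close> act on \<open>s\<close> amounts to multiplying by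
    \<open>h\<close> before reducing modulo \<open>f\<close>.\<close>
  have s: "rec_op h s n = coeff ((monom 1 n * h) mod f) (degree f - 1)" for h n
  proof (induction h arbitrary: n)
    case (pCons c h)
    have "monom 1 n * pCons c h = smult c (monom 1 n) + monom 1 (Suc n) * h"
      by (simp add: monom_Suc)
    then have "(monom 1 n * pCons c h) mod f
        = smult c (monom 1 n mod f) + (monom 1 (Suc n) * h) mod f"
      by (simp only: poly_mod_add_left mod_smult_left)
    then show ?case
      by (simp only: rec_op_pCons pCons.IH coeff_add coeff_smult s_def[of n])
  qed simp
  have per: "(\<forall>n. s (n + N) = s n) \<longleftrightarrow> f dvd unity_poly N" for N
  proof -
    have "(\<forall>n. s (n + N) = s n) \<longleftrightarrow> (\<forall>n. rec_op (unity_poly N) s n = 0)"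
      by (simp add: rec_op_unity_poly)
    then show ?thesis using coeff_shift_mod_zero_iff[OF f(1)] by (simp only: s)
  qed
  have sT: "s (n + T) = s n" for n using T(2)[OF T(1)] per[of T] by simp
  have iff: "f dvd unity_poly N \<longleftrightarrow> period s dvd N" for N
    using period_dvd_iff[where a = s, OF T(1) sT] per[of N] by blast
  have "period s dvd T" "T dvd period s"
    using T(2)[OF T(1)] T(2)[OF period_pos[where a = s, OF T(1) sT]] iff[of T] iff[of "period s"] dvd_refl by blast+
  then have "period s = T" by (rule dvd_antisym)
  moreover have "lin_rec (degree f) s"
    unfolding lin_rec_iff_rec_op[OF f(1)] s using f by (intro exI[of _ f]) simp
  then have "lin_rec k s" using f(2,1) by (rule lin_rec_mono)
  ultimately show ?thesis by (auto simp: Pset_def)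
qed

section \<open>Minimal polynomials over a finite field\<close>

text \<open>Multiplication by \<open>a\<close> permutes \<open>S\<close>, so the nonzero product
  over \<open>S\<close> picks up the factor \<open>a ^ card S\<close>. This serves both the base
  field and its extension by a root.\<close>

lemma power_card_eq_1:
  fixes a :: "'a::field"
  assumes "finite S" "0 \<notin> S" "a \<noteq> 0" "\<And>x. x \<in> S \<Longrightarrow> a * x \<in> S"
  shows "a ^ card S = 1"
proof -
  have inj: "inj_on ((*) a) S" using assms(3) by (auto intro: inj_onI)
  have "(*) a ` S = S" by (rule endo_inj_surj) (use assms inj in auto)
  then have "\<Prod>S = (\<Prod>x\<in>S. a * x)" using prod.reindex[OF inj, of "\<lambda>x. x"] by simp
  also have "\<dots> = a ^ card S * \<Prod>S" by (simp add: prod.distrib)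
  finally show ?thesis using assms(1,2) by (auto simp: prod_zero_iff)
qed

lemma finite_field_power_card:
  fixes c :: "'a::{finite,field}"
  shows "c ^ CARD('a) = c"
proof (cases "c = 0")
  case False
  have "c ^ card (UNIV - {0::'a}) = 1" by (rule power_card_eq_1) (use False in auto)
  moreover have "CARD('a) = Suc (card (UNIV - {0::'a}))"
    by (simp add: card_Diff_singleton)
  ultimately show ?thesis by (simp only: power_Suc mult_1_right)
qed simp

lemma card_polys_degree_less:
  assumes "m > 0"
  shows "finite {h :: 'a::{finite,comm_ring_1} poly. degree h < m}"
    and "card {h :: 'a::{finite,comm_ring_1} poly. degree h < m} = CARD('a) ^ m"
proof -
  let ?F = "{..<m} \<rightarrow>\<^sub>E (UNIV :: 'a set)"
  let ?p = "\<lambda>c :: nat \<Rightarrow> 'a. \<Sum>i<m. monom (c i) i"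
  have coeff: "coeff (?p c) j = (if j < m then c j else 0)" for c j
    by (auto simp: coeff_sum)
  have "bij_betw ?p ?F {h. degree h < m}"
  proof (rule bij_betw_imageI)
    show "inj_on ?p ?F"
    proof (rule inj_onI)
      fix c d assume cd: "c \<in> ?F" "d \<in> ?F" "?p c = ?p d"
      then have "c j = d j" if "j < m" for j using that coeff[of c j] coeff[of d j] by simp
      with cd show "c = d" by (intro PiE_ext[of c "{..<m}" _ d]) auto
    qed
    show "?p ` ?F = {h. degree h < m}"
    proof (intro equalityI subsetI)
      fix h assume "h \<in> ?p ` ?F"
      then obtain c where h: "h = ?p c" by auto
      have "degree h \<le> m - 1" unfolding h by (rule degree_le) (auto simp: coeff)
      then show "h \<in> {h. degree h < m}" using assms by simp
    next
      fix h :: "'a poly" assume h: "h \<in> {h. degree h < m}"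
      let ?c = "restrict (coeff h) {..<m}"
      have "?p ?c = h" by (rule poly_eqI) (use h in \<open>auto simp: coeff coeff_eq_0\<close>)
      then show "h \<in> ?p ` ?F" by (intro image_eqI[of _ _ ?c]) auto
    qed
  qed
  then show "finite {h :: 'a poly. degree h < m}" "card {h :: 'a poly. degree h < m} = CARD('a) ^ m"
    using bij_betw_finite[of ?p ?F] bij_betw_same_card[of ?p ?F] by (auto simp: card_PiE finite_PiE)
qed

section \<open>Evaluation in the algebraic closure and minimal polynomials\<close>

lemma map_poly_to_ac_add: "map_poly to_ac (f + g) = map_poly to_ac f + map_poly to_ac g"
  by (rule poly_eqI) (simp add: coeff_map_poly)

lemma map_poly_to_ac_diff: "map_poly to_ac (f - g) = map_poly to_ac f - map_poly to_ac g"
  by (rule poly_eqI) (simp add: coeff_map_poly)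

lemma map_poly_to_ac_mult: "map_poly to_ac (f * g) = map_poly to_ac f * map_poly to_ac g"
  by (rule poly_eqI) (simp add: coeff_map_poly coeff_mult to_ac_sum)

lemma map_poly_to_ac_power: "map_poly to_ac (f ^ n) = map_poly to_ac f ^ n"
  by (induction n) (simp_all add: map_poly_to_ac_mult)

lemma map_poly_to_ac_unity_poly [simp]:
  "map_poly to_ac (unity_poly N) = unity_poly N"
  by (simp add: map_poly_to_ac_diff map_poly_monom)

abbreviation ev :: "'a::field poly \<Rightarrow> 'a alg_closure \<Rightarrow> 'a alg_closure" where
  "ev h x \<equiv> poly (map_poly to_ac h) x"

lemma ev_unity_poly: "ev (unity_poly N) x = 0 \<longleftrightarrow> x ^ N = 1"
  by (simp add: poly_monom)

lemma ev_pCons: "ev (pCons c h) x = to_ac c + x * ev h x"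
  by (simp add: map_poly_pCons)

text \<open>Take an annihilating polynomial of least degree. Remainders modulo it also annihilate
  \<open>x\<close>, so they vanish; scaling makes it monic.\<close>

lemma ex_min_poly:
  fixes x :: "'a::field alg_closure"
  shows "\<exists>g. lead_coeff g = 1 \<and> (\<forall>h. ev h x = 0 \<longleftrightarrow> g dvd h)"
proof -
  let ?P = "\<lambda>g. g \<noteq> 0 \<and> ev g x = 0"
  obtain f where f: "?P f" using alg_closure_algebraic[of x] by blast
  define g where "g = arg_min degree ?P"
  have g: "?P g" and min: "\<And>h. ?P h \<Longrightarrow> degree g \<le> degree h"
    using arg_min_nat_lemma[of ?P f degree] f by (auto simp: g_def)
  have dvd: "ev h x = 0 \<longleftrightarrow> g dvd h" for h
  proof
    assume h: "ev h x = 0"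
    have "h mod g = h - h div g * g" by (simp add: minus_div_mult_eq_mod)
    then have "ev (h mod g) x = 0"
      using h g by (simp add: map_poly_to_ac_diff map_poly_to_ac_mult)
    then have "h mod g = 0" using min[of "h mod g"] degree_mod_less'[of g h] g by (meson not_le)
    then show "g dvd h" by auto
  qed (use g in \<open>auto simp: map_poly_to_ac_mult elim!: dvdE\<close>)
  show ?thesis
    by (rule exI[of _ "smult (inverse (lead_coeff g)) g"]) (use g dvd in \<open>simp add: smult_dvd_iff\<close>)
qed

definition min_poly :: "'a::field alg_closure \<Rightarrow> 'a poly" where
  "min_poly x = (SOME g. lead_coeff g = 1 \<and> (\<forall>h. ev h x = 0 \<longleftrightarrow> g dvd h))"

lemma lead_coeff_min_poly [simp]: "lead_coeff (min_poly x) = 1"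
  and min_poly_dvd_iff: "min_poly x dvd h \<longleftrightarrow> ev h x = 0"
proof -
  have "lead_coeff (min_poly x) = 1 \<and> (\<forall>h. ev h x = 0 \<longleftrightarrow> min_poly x dvd h)"
    unfolding min_poly_def by (rule someI_ex[OF ex_min_poly])
  then show "lead_coeff (min_poly x) = 1" "min_poly x dvd h \<longleftrightarrow> ev h x = 0" by blast+
qed

lemma ev_min_poly [simp]: "ev (min_poly x) x = 0"
  using min_poly_dvd_iff[of x "min_poly x"] by simp

lemma min_poly_nonzero [simp]: "min_poly x \<noteq> 0"
  using lead_coeff_min_poly[of x] by fastforce

lemma degree_min_poly_pos [simp]: "degree (min_poly x) > 0"
proof (rule ccontr)
  assume "\<not> 0 < degree (min_poly x)"
  then have "is_unit (min_poly x)" by (simp add: is_unit_iff_degree)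
  then show False by (simp add: min_poly_dvd_iff)
qed

text \<open>Hence the values of these polynomials at \<open>x\<close> number exactly
  \<open>q^m\<close>, with \<open>m\<close> the degree of \<open>min_poly x\<close>.\<close>

lemma inj_on_ev_min_poly: "inj_on (\<lambda>h. ev h x) {h. degree h < degree (min_poly x)}"
proof (rule inj_onI)
  fix f h assume *: "f \<in> {h. degree h < degree (min_poly x)}" "h \<in> {h. degree h < degree (min_poly x)}"
    "ev f x = ev h x"
  then have "min_poly x dvd f - h" by (simp add: min_poly_dvd_iff map_poly_to_ac_diff)
  moreover have "degree (f - h) < degree (min_poly x)"
    using * degree_diff_le_max[of f h] by auto
  ultimately show "f = h" using dvd_imp_degree_le[of "min_poly x" "f - h"] by auto
qed

text \<open>The values \<open>ev h x\<close> with \<open>degree h < m\<close> form the field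
  generated by \<open>x\<close>, of size \<open>q^m\<close>; multiplication by \<open>x\<close>
  permutes its nonzero elements.\<close>

lemma root_power_eq_1:
  fixes x :: "'a::{finite,field} alg_closure"
  assumes "x \<noteq> 0"
  shows "x ^ (CARD('a) ^ degree (min_poly x) - 1) = 1"
proof -
  define m where "m = degree (min_poly x)"
  let ?H = "{h :: 'a poly. degree h < m}"
  let ?S = "(\<lambda>h. ev h x) ` ?H"
  have m: "m > 0" by (simp add: m_def)
  have "card ?S = CARD('a) ^ m"
    using inj_on_ev_min_poly[of x] card_polys_degree_less[OF m, where 'a='a]
    by (simp add: card_image m_def)
  moreover have fin: "finite ?S" by (intro finite_imageI card_polys_degree_less m)
  moreover have "0 \<in> ?S" using m by (intro image_eqI[of _ _ 0]) auto
  ultimately have "card (?S - {0}) = CARD('a) ^ m - 1" by simp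
  moreover have "x ^ card (?S - {0}) = 1"
  proof (rule power_card_eq_1)
    fix y assume "y \<in> ?S - {0}"
    then obtain h where h: "y = ev h x" "y \<noteq> 0" by auto
    \<comment> \<open>Multiplying by \<open>X\<close> may raise the degree to \<open>m\<close>;
      reduction restores the bound without changing the value at \<open>x\<close>.\<close>
    let ?r = "pCons 0 h mod min_poly x"
    have "?r = pCons 0 h - pCons 0 h div min_poly x * min_poly x"
      by (simp add: minus_div_mult_eq_mod)
    then have "ev ?r x = x * y"
      by (simp add: map_poly_to_ac_diff map_poly_to_ac_mult ev_pCons h(1) del: mult_pCons_left)
    moreover have "degree ?r < m"
      using degree_mod_less[of "min_poly x" "pCons 0 h"] m by (auto simp: m_def)
    ultimately have "x * y \<in> ?S" by (intro image_eqI[of _ _ ?r]) auto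
    then show "x * y \<in> ?S - {0}" using h(2) assms by simp
  qed (use fin assms in auto)
  ultimately show ?thesis by (simp add: m_def)
qed

text \<open>The polynomials \<open>(X + 1)\<^sup>q\<close> and \<open>X\<^sup>q + 1\<close> are monic of degree \<open>q\<close> and agree on all
  of the field with \<open>q\<close> elements, so they are equal.\<close>
lemma one_plus_power_card:
  fixes x :: "'a::{finite,field} alg_closure"
  shows "(x + 1) ^ CARD('a) = x ^ CARD('a) + 1"
proof -
  let ?q = "CARD('a)"
  have q: "?q > 0" by simp
  have "[:1, 1:] ^ ?q = monom 1 ?q + (1 :: 'a poly)"
  proof (rule poly_eqI_degree_lead_coeff[of _ ?q _ UNIV])
    have "lead_coeff ([:1, 1 :: 'a:] ^ ?q) = 1" by (simp add: lead_coeff_power)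
    then show "coeff ([:1, 1 :: 'a:] ^ ?q) ?q = coeff (monom 1 ?q + 1) ?q"
      using q by (simp add: degree_linear_power)
    show "degree (monom 1 ?q + (1 :: 'a poly)) \<le> ?q"
      by (rule degree_add_le) (auto simp: degree_monom_le)
  qed (auto simp: degree_linear_power poly_monom finite_field_power_card)
  then have "ev ([:1, 1:] ^ ?q) x = ev (monom 1 ?q + (1 :: 'a poly)) x" by simp
  then show ?thesis
    by (simp add: map_poly_to_ac_power map_poly_to_ac_add map_poly_monom poly_monom map_poly_pCons add.commute)
qed

lemma add_power_card:
  fixes x y :: "'a::{finite,field} alg_closure"
  shows "(x + y) ^ CARD('a) = x ^ CARD('a) + y ^ CARD('a)"
proof (cases "y = 0")
  case False
  \<comment> \<open>Dividing by \<open>y\<close> reduces to the case where one summand is 1.\<close>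
  then have "x + y = (x / y + 1) * y" by (simp add: field_simps)
  then have "(x + y) ^ CARD('a) = ((x / y) ^ CARD('a) + 1) * y ^ CARD('a)"
    by (simp only: power_mult_distrib one_plus_power_card)
  then show ?thesis using False by (simp add: field_simps)
qed simp

lemma add_power_card_power:
  fixes x y :: "'a::{finite,field} alg_closure"
  shows "(x + y) ^ CARD('a) ^ i = x ^ CARD('a) ^ i + y ^ CARD('a) ^ i"
  by (induction i) (simp_all add: power_mult mult.commute[of "CARD('a)"] add_power_card)

text \<open>The \<open>q^i\<close>-th power map is additive and multiplicative and fixes the
  coefficients, which lie in the base field.\<close>

lemma ev_power_card_power:
  fixes x :: "'a::{finite,field} alg_closure"
  shows "ev h x ^ CARD('a) ^ i = ev h (x ^ CARD('a) ^ i)"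
proof (induction h)
  case (pCons c h)
  have "c ^ CARD('a) ^ i = c"
    by (induction i) (simp_all add: power_mult mult.commute[of "CARD('a)"] finite_field_power_card)
  then show ?case
    by (simp add: ev_pCons add_power_card_power power_mult_distrib pCons.IH flip: to_ac_power)
qed simp

text \<open>All \<open>q^m\<close> elements generated by \<open>x\<close> are fixed by the
  \<open>q^i\<close>-th power map, hence are roots of \<open>X^(q^i) - X\<close>, which has at most
  \<open>q^i\<close> of them.\<close>

lemma degree_min_poly_le:
  fixes x :: "'a::{finite,field} alg_closure"
  assumes "x ^ CARD('a) ^ i = x" "i > 0"
  shows "degree (min_poly x) \<le> i"
proof -
  define m where "m = degree (min_poly x)"
  let ?q = "CARD('a)"
  let ?H = "{h :: 'a poly. degree h < m}"
  let ?f = "monom 1 (?q ^ i) - monom 1 1 :: 'a alg_closure poly"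
  have q: "?q > 1" using card_mono[of UNIV "{0, 1 :: 'a}"] by simp
  then have "?q ^ i > 1" using assms(2) by (rule one_less_power)
  then have "coeff ?f (?q ^ i) = 1" by simp
  then have f: "?f \<noteq> 0" by (metis coeff_0 zero_neq_one)
  have m: "m > 0" by (simp add: m_def)
  have "?q ^ m = card ((\<lambda>h. ev h x) ` ?H)"
    using inj_on_ev_min_poly[of x] card_polys_degree_less[OF m, where 'a='a]
    by (simp add: card_image m_def)
  also have "\<dots> \<le> card {y. poly ?f y = 0}"
    using f by (intro card_mono poly_roots_finite) (auto simp: poly_monom ev_power_card_power assms)
  also have "\<dots> \<le> degree ?f" by (rule card_poly_roots_bound[OF f])
  also have "\<dots> \<le> ?q ^ i"
    using \<open>?q ^ i > 1\<close> by (intro degree_diff_le) (auto intro: order_trans[OF degree_monom_le])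
  finally show ?thesis using q by (simp add: m_def)
qed

section \<open>Elements and polynomials of prescribed order\<close>

text \<open>Translation by 1 permutes the field, so the sum of its elements equals itself plus
  \<open>CARD('a)\<close> times 1.\<close>

lemma of_nat_card_eq_0: "of_nat CARD('a) = (0 :: 'a::{finite,field})"
proof -
  have "(\<Sum>c\<in>UNIV. c :: 'a) = (\<Sum>c\<in>UNIV. c + 1)"
    by (rule sum.reindex_bij_witness[of _ "\<lambda>c. c + 1" "\<lambda>c. c - 1"]) auto
  then show ?thesis by (simp add: sum.distrib)
qed

lemma CHAR_dvd_card: "CHAR('a::{finite,field}) dvd CARD('a)"
  using of_nat_card_eq_0[where 'a='a] by (simp add: of_nat_eq_0_iff_char_dvd)

lemma prime_CHAR_finite: "prime CHAR('a::{finite,field})"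
  by (intro prime_CHAR_semidom finite_imp_CHAR_pos) simp

lemma card_field_gt_1: "CARD('a::{finite,field}) > 1"
  using card_mono[of UNIV "{0, 1 :: 'a}"] by simp

text \<open>Since \<open>p\<close> divides \<open>q^i\<close>, it would divide 1. Consequently
  divisors of \<open>q^i - 1\<close> are prime to \<open>p\<close>.\<close>

lemma not_CHAR_dvd_card_power_minus_1:
  assumes "i > 0"
  shows "\<not> CHAR('a::{finite,field}) dvd CARD('a) ^ i - 1"
proof
  assume "CHAR('a) dvd CARD('a) ^ i - 1"
  moreover have "CHAR('a) dvd CARD('a) ^ i"
    using CHAR_dvd_card[where 'a='a] assms by (simp add: dvd_power_iff dvd_power_same dvd_trans[OF _ dvd_power])
  moreover have "CARD('a) ^ i \<ge> 1" using card_field_gt_1[where 'a='a] by simp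
  ultimately have "CHAR('a) dvd 1" by (metis dvd_diff_nat diff_diff_cancel)
  then show False using prime_CHAR_finite[where 'a='a] by auto
qed

section \<open>Simple roots and the field with \<open>q^i\<close> elements\<close>

lemma double_root_imp_pderiv_root:
  fixes f :: "'a::idom poly"
  assumes "[:-x, 1:] ^ 2 dvd f"
  shows "poly (pderiv f) x = 0"
proof -
  from assms obtain h where "f = [:-x, 1:] ^ 2 * h" by (elim dvdE)
  then have "pderiv f = [:-x, 1:] * ([:-x, 1:] * pderiv h + h * (2 * pderiv [:-x, 1:]))"
    by (simp only: pderiv_mult power2_eq_square algebra_simps mult_2)
  then show ?thesis by (simp only: poly_mult) simp
qed

text \<open>\<open>f\<close> splits into linear factors, and a repeated factor would give a root
  shared with the derivative; so the multiset of roots has no repetition.\<close>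

lemma card_roots_eq_degree:
  fixes f :: "'a::alg_closed_field poly"
  assumes "f \<noteq> 0" "\<And>x. poly f x = 0 \<Longrightarrow> poly (pderiv f) x \<noteq> 0"
  shows "card {x. poly f x = 0} = degree f"
proof (rule antisym)
  show "card {x. poly f x = 0} \<le> degree f" by (rule card_poly_roots_bound) fact
  obtain A where A: "size A = degree f" "f = smult (lead_coeff f) (\<Prod>x\<in>#A. [:-x, 1:])"
    using alg_closed_imp_factorization[OF assms(1)] by blast
  have dvd: "(\<Prod>x\<in>#A. [:-x, 1:]) dvd f" by (subst A(2)) (rule dvd_smult, rule dvd_refl)
  have root: "poly f x = 0" if "x \<in># A" for x
  proof -
    from that obtain B where "A = add_mset x B" by (auto dest: multi_member_split)
    then have "[:-x, 1:] dvd f" using dvd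
      by (auto elim: dvd_mult_left simp del: mult_pCons_left mult_pCons_right)
    then show ?thesis by (simp add: poly_eq_0_iff_dvd)
  qed
  have "count A x \<le> 1" if "x \<in># A" for x
  proof (rule ccontr)
    assume "\<not> count A x \<le> 1"
    from that obtain B where B: "A = add_mset x B" by (auto dest: multi_member_split)
    with \<open>\<not> count A x \<le> 1\<close> have "x \<in># B" by auto
    then obtain C where "B = add_mset x C" by (auto dest: multi_member_split)
    then have "[:-x, 1:] ^ 2 dvd f" using dvd B
      by (auto simp: power2_eq_square mult.assoc[symmetric] elim: dvd_mult_left simp del: mult_pCons_left mult_pCons_right)
    then show False using assms(2)[OF root[OF that]] double_root_imp_pderiv_root by blast
  qed
  then have "size A \<le> card (set_mset A)"
    unfolding size_multiset_overloaded_eq using sum_mono[of "set_mset A" "count A" "\<lambda>_. 1"] by simp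
  also have "\<dots> \<le> card {x. poly f x = 0}"
    by (rule card_mono) (use root poly_roots_finite[OF assms(1)] in auto)
  finally show "degree f \<le> card {x. poly f x = 0}" by (simp add: A(1))
qed

text \<open>\<open>X^Q - X\<close> with \<open>Q = q^i\<close> has derivative -1, because
  \<open>p\<close> divides \<open>Q\<close>; so all its roots are simple.\<close>

lemma card_fixed_points:
  assumes "i > 0"
  shows "card {x :: 'a::{finite,field} alg_closure. x ^ CARD('a) ^ i = x} = CARD('a) ^ i"
proof -
  let ?Q = "CARD('a) ^ i"
  let ?f = "monom 1 ?Q - monom 1 1 :: 'a alg_closure poly"
  have Q: "?Q > 1" using card_field_gt_1 assms by (rule one_less_power)
  then have c: "coeff ?f ?Q = 1" by simp
  then have f: "?f \<noteq> 0" by (metis coeff_0 zero_neq_one)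
  have "degree ?f \<le> ?Q"
    using Q by (intro degree_diff_le) (auto intro: order_trans[OF degree_monom_le])
  moreover have "?Q \<le> degree ?f" by (rule le_degree) (simp only: c, simp)
  ultimately have deg: "degree ?f = ?Q" by simp
  have "CHAR('a) dvd ?Q" using CHAR_dvd_card[where 'a='a] assms by (auto intro: dvd_trans[OF _ dvd_power])
  then have "of_nat ?Q = (0 :: 'a alg_closure)" by (simp only: of_nat_eq_0_iff_char_dvd CHAR_alg_closure)
  then have "poly (pderiv ?f) x \<noteq> 0" for x
    by (simp add: pderiv_diff pderiv_monom poly_monom del: of_nat_power)
  with card_roots_eq_degree[OF f] show ?thesis by (simp only: deg) (simp add: poly_monom)
qed

text \<open>The fixed points of the \<open>q^i\<close>-th power map form a finite field; a generator
  of its cyclic multiplicative group has the required order.\<close>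

lemma ex_primitive_root:
  assumes "i > 0"
  shows "\<exists>x :: 'a::{finite,field} alg_closure. \<forall>N. x ^ N = 1 \<longleftrightarrow> CARD('a) ^ i - 1 dvd N"
proof -
  let ?Q = "CARD('a) ^ i"
  define F where "F = {x :: 'a alg_closure. x ^ ?Q = x}"
  \<comment> \<open>The fixed points as a ring record, to which the cyclicity theorem for finite
    fields applies.\<close>
  define R :: "'a alg_closure ring" where
    "R = \<lparr>carrier = F, monoid.mult = (*), one = 1, zero = 0, add = (+)\<rparr>"
  have Q: "?Q > 1" using card_field_gt_1 assms by (rule one_less_power)
  have card: "card F = ?Q" unfolding F_def using assms by (rule card_fixed_points)
  then have fin: "finite F" using Q by (intro card_ge_0_finite) simp
  have F: "0 \<in> F" "1 \<in> F" "\<And>x y. x \<in> F \<Longrightarrow> y \<in> F \<Longrightarrow> x + y \<in> F"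
      "\<And>x y. x \<in> F \<Longrightarrow> y \<in> F \<Longrightarrow> x * y \<in> F" "\<And>x. x \<in> F \<Longrightarrow> inverse x \<in> F"
    using Q by (auto simp: F_def add_power_card_power power_mult_distrib power_inverse)
  \<comment> \<open>Additivity applied to \<open>x + (- x) = 0\<close> settles this without knowing
    the parity of \<open>?Q\<close>.\<close>
  have neg: "- x \<in> F" if "x \<in> F" for x
    using add_power_card_power[of x "- x" i] that Q by (simp add: F_def add_eq_0_iff power_0_left)
  interpret R: cring R
  proof (intro cringI abelian_groupI comm_monoidI)
    fix x assume "x \<in> carrier R"
    then show "\<exists>y\<in>carrier R. y \<oplus>\<^bsub>R\<^esub> x = \<zero>\<^bsub>R\<^esub>"
      using neg by (intro bexI[of _ "- x"]) (auto simp: R_def)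
  qed (auto simp: R_def F algebra_simps)
  interpret R: field R
  proof (rule R.cring_fieldI2)
    fix x assume "x \<in> carrier R" "x \<noteq> \<zero>\<^bsub>R\<^esub>"
    then show "\<exists>y\<in>carrier R. x \<otimes>\<^bsub>R\<^esub> y = \<one>\<^bsub>R\<^esub>"
      using F by (intro bexI[of _ "inverse x"]) (auto simp: R_def)
  qed (simp add: R_def)
  have pow: "x [^]\<^bsub>R\<^esub> n = x ^ n" for x :: "'a alg_closure" and n :: nat
    by (induction n) (simp_all add: R_def nat_pow_def mult.commute)
  obtain x where x: "x \<in> F" "x \<noteq> 0" "F - {0} = {x ^ n | n. n \<in> UNIV}"
    using R.finite_field_mult_group_has_gen fin by (auto simp: pow) (auto simp: R_def)
  have "x ^ Suc (?Q - 1) = x" using x(1) Q by (simp add: F_def)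
  then have one: "x ^ (?Q - 1) = 1" using x(2) by (simp only: power_Suc mult_cancel_left1) simp
  \<comment> \<open>If \<open>x ^ e = 1\<close> with \<open>e > 0\<close>, the powers of
    \<open>x\<close> take at most \<open>e\<close> values, yet they exhaust the
    \<open>?Q - 1\<close> nonzero elements.\<close>
  have le: "?Q - 1 \<le> e" if e: "x ^ e = 1" "e > 0" for e
  proof -
    have "x ^ n \<in> (\<lambda>n. x ^ n) ` {..<e}" for n
    proof -
      have "x ^ n = x ^ (e * (n div e) + n mod e)" by simp
      also have "\<dots> = x ^ (n mod e)" by (simp only: power_add power_mult e(1) power_one mult_1_left)
      finally show ?thesis using e(2) by (intro image_eqI[of _ _ "n mod e"]) auto
    qed
    then have "F - {0} \<subseteq> (\<lambda>n. x ^ n) ` {..<e}" unfolding x(3) by auto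
    then have "card (F - {0}) \<le> card {..<e}" by (rule surj_card_le[rotated]) simp
    then show ?thesis using card F(1) fin by simp
  qed
  have "?Q - 1 dvd N" if "x ^ N = 1" for N
  proof -
    have "x ^ ((?Q - 1) * (N div (?Q - 1)) + N mod (?Q - 1)) = 1" using that by simp
    then have "x ^ (N mod (?Q - 1)) = 1"
      by (simp only: power_add power_mult one power_one mult_1_left)
    moreover have "N mod (?Q - 1) < ?Q - 1" using Q by simp
    ultimately have "N mod (?Q - 1) = 0" using le[of "N mod (?Q - 1)"] by linarith
    then show ?thesis by auto
  qed
  moreover have "x ^ N = 1" if "?Q - 1 dvd N" for N
    using that one by (auto elim!: dvdE simp: power_mult)
  ultimately show ?thesis by (intro exI[of _ x]) blast
qed

text \<open>Raise a primitive root to the cofactor \<open>e\<close> of \<open>d\<close> in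
  \<open>q^i - 1\<close>; as \<open>e > 0\<close>, it cancels from the divisibility.\<close>

lemma ex_element_of_order:
  assumes "i > 0" "d dvd CARD('a) ^ i - 1"
  shows "\<exists>x :: 'a::{finite,field} alg_closure. \<forall>N. x ^ N = 1 \<longleftrightarrow> d dvd N"
proof -
  obtain x :: "'a alg_closure" where x: "\<And>N. x ^ N = 1 \<longleftrightarrow> CARD('a) ^ i - 1 dvd N"
    using ex_primitive_root[OF assms(1)] by blast
  obtain e where e: "CARD('a) ^ i - 1 = d * e" using assms(2) by (auto elim: dvdE)
  have "CARD('a) ^ i > 1" using card_field_gt_1 assms(1) by (rule one_less_power)
  with e have "e > 0" by (intro Nat.gr0I) simp
  then have "(x ^ e) ^ N = 1 \<longleftrightarrow> d dvd N" for N
    unfolding power_mult[symmetric] x e by (simp add: mult.commute[of d])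
  then show ?thesis by blast
qed

section \<open>Orders of powers of minimal polynomials\<close>

lemma unity_poly_dvd:
  assumes "a dvd b"
  shows "(unity_poly a :: 'a::comm_ring_1 poly) dvd unity_poly b"
proof -
  from assms obtain c where "b = a * c" by (auto elim: dvdE)
  then have "(unity_poly b :: 'a poly) = monom 1 a ^ c - 1" by (simp add: monom_power)
  then show ?thesis by (simp add: power_diff_1_eq)
qed

lemma unity_poly_power_CHAR:
  assumes "prime CHAR('a::comm_ring_1)"
  shows "(unity_poly M :: 'a poly) ^ CHAR('a) ^ t = unity_poly (M * CHAR('a) ^ t)"
proof -
  \<comment> \<open>Writing \<open>X^M\<close> as \<open>(X^M - 1) + 1\<close> avoids signs in the
    additive power map.\<close>
  have "(unity_poly M + 1 :: 'a poly) ^ CHAR('a) ^ t = unity_poly M ^ CHAR('a) ^ t + 1 ^ CHAR('a) ^ t"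
    using assms by (intro freshmans_dream'[of _ t]) simp_all
  then show ?thesis by (simp add: monom_power)
qed

lemma order_power:
  fixes f :: "'a::idom poly"
  assumes "f \<noteq> 0"
  shows "Polynomial.order x (f ^ n) = n * Polynomial.order x f"
  using assms by (induction n) (simp_all add: order_mult)

text \<open>The bounds on \<open>r\<close> make \<open>p^j\<close> the least power of
  \<open>p\<close> that is at least \<open>r\<close>; for \<open>j = 0\<close> they leave only
  \<open>r = 1\<close>.\<close>

lemma CHAR_power_mult_in_Pset:
  assumes i: "i > 0" "d dvd CARD('a::{finite,field}) ^ i - 1"
    and r: "r > 0" "r * i \<le> k" "r \<le> CHAR('a) ^ j" "j > 0 \<Longrightarrow> CHAR('a) ^ (j - 1) < r"
  shows "CHAR('a) ^ j * d \<in> Pset k TYPE('a)"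
proof -
  let ?p = "CHAR('a)"
  have prime: "prime ?p" by (rule prime_CHAR_finite)
  have pd: "\<not> ?p dvd d"
    using not_CHAR_dvd_card_power_minus_1[OF i(1), where 'a='a] i(2) dvd_trans by blast
  then have d: "d > 0" by (intro Nat.gr0I) auto
  obtain x :: "'a alg_closure" where x: "\<And>N. x ^ N = 1 \<longleftrightarrow> d dvd N"
    using ex_element_of_order[OF i] by blast
  have x0: "x \<noteq> 0" using x[of d] d by (auto simp: power_0_left)
  define g where "g = min_poly x"
  define f where "f = g ^ r"
  have "x ^ CARD('a) ^ i = x ^ Suc (CARD('a) ^ i - 1)" using card_field_gt_1[where 'a='a] by simp
  also have "\<dots> = x" unfolding power_Suc using x[of "CARD('a) ^ i - 1"] i(2) by simp
  finally have "degree g \<le> i" unfolding g_def using i(1) by (rule degree_min_poly_le)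
  then have "degree f \<le> r * i" by (simp add: f_def degree_power_eq g_def)
  then have deg: "degree f \<le> k" using r by simp
  have degpos: "degree f > 0" using r by (simp add: f_def degree_power_eq g_def)
  have lead: "lead_coeff f = 1" by (simp add: f_def lead_coeff_power g_def)
  have gd: "g dvd unity_poly d" by (simp add: g_def min_poly_dvd_iff ev_unity_poly x del: map_poly_to_ac_unity_poly)
  \<comment> \<open>The constant term of \<open>g\<close> divides that of \<open>X^d - 1\<close>,
    which is -1.\<close>
  have "coeff g 0 \<noteq> 0"
  proof
    assume "coeff g 0 = 0"
    obtain h where "unity_poly d = g * h" using gd by (elim dvdE)
    then have "coeff (unity_poly d) 0 = coeff g 0 * coeff h 0" by (simp only: coeff_mult_0)
    then show False using d \<open>coeff g 0 = 0\<close> by simp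
  qed
  then have coeff: "coeff f 0 \<noteq> 0" by (simp add: f_def coeff_0_power)
  have "f dvd unity_poly N \<longleftrightarrow> ?p ^ j * d dvd N" if N: "N > 0" for N
  proof
    assume "?p ^ j * d dvd N"
    have "f dvd unity_poly d ^ r" unfolding f_def by (rule dvd_power_same[OF gd])
    also have "\<dots> dvd unity_poly d ^ (?p ^ j)" by (rule le_imp_power_dvd) fact
    also have "\<dots> = unity_poly (d * ?p ^ j)" by (rule unity_poly_power_CHAR[OF prime])
    also have "\<dots> dvd unity_poly N" using \<open>?p ^ j * d dvd N\<close>
      by (intro unity_poly_dvd) (simp add: mult.commute)
    finally show "f dvd unity_poly N" .
  next
    assume fN: "f dvd unity_poly N"
    have "\<not> is_unit ?p" using prime by auto
    \<comment> \<open>Split off the full power \<open>p^s\<close> of \<open>p\<close> in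
      \<open>N\<close>: then \<open>X^N - 1\<close> is the \<open>p^s\<close>-th power of
      \<open>X^M - 1\<close>.\<close>
    then obtain M where M: "N = ?p ^ multiplicity ?p N * M" "\<not> ?p dvd M"
      using multiplicity_decompose'[of N ?p] N by auto
    define s where "s = multiplicity ?p N"
    have "g dvd f" using r by (simp add: f_def dvd_power)
    then have "ev (unity_poly N) x = 0" using fN unfolding g_def min_poly_dvd_iff[symmetric] by (rule dvd_trans)
    then have dN: "d dvd N" by (simp only: ev_unity_poly x)
    let ?u = "unity_poly M :: 'a alg_closure poly"
    have M0: "M > 0" using M N by (intro Nat.gr0I) simp
    have "coeff ?u M = 1" using M0 by simp
    then have u0: "?u \<noteq> 0" by (metis coeff_0 zero_neq_one)
    \<comment> \<open>The derivative \<open>M X^(M-1)\<close> does not vanish at \<open>x\<close>,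
      so \<open>x\<close> is at most a simple root of \<open>X^M - 1\<close>.\<close>
    have "poly (pderiv ?u) x \<noteq> 0" 
      using M(2) x0 by (simp add: pderiv_diff pderiv_monom poly_monom of_nat_eq_0_iff_char_dvd)
    then have "\<not> [:-x, 1:] ^ 2 dvd ?u" using double_root_imp_pderiv_root by blast
    then have ord: "Polynomial.order x ?u \<le> 1" using u0 by (simp add: order_divides)
    have "[:-x, 1:] dvd map_poly to_ac g" by (simp add: g_def flip: poly_eq_0_iff_dvd)
    then have "[:-x, 1:] ^ r dvd map_poly to_ac f" unfolding f_def map_poly_to_ac_power by (rule dvd_power_same)
    also have "\<dots> dvd map_poly to_ac (unity_poly N)"
      using fN by (auto elim!: dvdE simp: map_poly_to_ac_mult simp del: map_poly_to_ac_unity_poly)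
    also have "\<dots> = unity_poly (M * CHAR('a alg_closure) ^ s)" using M(1) by (simp add: s_def mult.commute)
    also have "\<dots> = ?u ^ (CHAR('a alg_closure) ^ s)" using prime by (intro unity_poly_power_CHAR[symmetric]) simp
    \<comment> \<open>Compare the multiplicities of \<open>x\<close> on both sides of the
      divisibility.\<close>
    finally have "r \<le> ?p ^ s * Polynomial.order x ?u" using u0 by (simp add: order_divides order_power)
    also have "\<dots> \<le> ?p ^ s" using ord by simp
    finally have rs: "r \<le> ?p ^ s" .
    have "j \<le> s"
    proof (cases "j > 0")
      case True
      with r(4) rs have "?p ^ (j - 1) < ?p ^ s" by simp
      then have "j - 1 < s" using prime_gt_1_nat[OF prime] by simp
      then show ?thesis by simp
    qed simp
    then have "?p ^ j dvd N" using multiplicity_dvd'[of j ?p N] by (simp add: s_def)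
    moreover have "coprime (?p ^ j) d" using prime pd by (simp add: prime_imp_coprime)
    ultimately show "?p ^ j * d dvd N" using dN by (intro divides_mult)
  qed
  moreover have "?p ^ j * d > 0" using d prime_gt_0_nat[OF prime] by simp
  ultimately show ?thesis using order_in_Pset[OF degpos deg lead coeff] by blast
qed

section \<open>Polynomials dividing \<open>X\<^sup>N - 1\<close>\<close>

lemma dvd_power_minus_1: "a - 1 dvd a ^ n - (1 :: nat)"
proof (induction n)
  case (Suc n)
  have "a ^ Suc n - 1 = a * (a ^ n - 1) + (a - 1)"
    by (cases "a = 0") (simp_all add: diff_mult_distrib2)
  with Suc show ?case by simp
qed simp

lemma ex_ev_root:
  assumes "degree f > 0"
  shows "\<exists>x. ev f x = 0"
  using assms by (intro alg_closed_imp_poly_has_root) (simp add: degree_map_poly)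

lemma ev_root_nonzero: "coeff f 0 \<noteq> 0 \<Longrightarrow> ev f x = 0 \<Longrightarrow> x \<noteq> 0"
  by (auto simp: poly_0_coeff_0 coeff_map_poly)

text \<open>If \<open>m\<close> divides \<open>i\<close>, then \<open>q^m - 1\<close> divides
  \<open>q^i - 1\<close>.\<close>

lemma min_poly_dvd_unity_poly:
  fixes x :: "'a::{finite,field} alg_closure"
  assumes "x \<noteq> 0" "degree (min_poly x) dvd i"
  shows "min_poly x dvd unity_poly (CARD('a) ^ i - 1)"
proof -
  obtain e where e: "i = degree (min_poly x) * e" using assms(2) by (auto elim: dvdE)
  have "min_poly x dvd unity_poly (CARD('a) ^ degree (min_poly x) - 1)"
    using root_power_eq_1[OF assms(1)]
    by (simp add: min_poly_dvd_iff ev_unity_poly del: map_poly_to_ac_unity_poly)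
  also have "CARD('a) ^ degree (min_poly x) - 1 dvd CARD('a) ^ i - 1"
    unfolding e power_mult by (rule dvd_power_minus_1)
  then have "unity_poly (CARD('a) ^ degree (min_poly x) - 1) dvd (unity_poly (CARD('a) ^ i - 1) :: 'a poly)"
    by (rule unity_poly_dvd)
  finally show ?thesis .
qed

text \<open>Evaluation at \<open>x\<close> has prime kernel, generated by \<open>min_poly x\<close>; this replaces coprimality.\<close>
lemma min_poly_mult_dvd:
  assumes "min_poly x dvd A" "h dvd A" "\<not> min_poly x dvd h"
  shows "min_poly x * h dvd A"
proof -
  obtain w where w: "A = h * w" using assms(2) by (auto elim: dvdE)
  then have "min_poly x dvd w"
    using assms(1,3) by (simp add: min_poly_dvd_iff map_poly_to_ac_mult)
  then show ?thesis by (simp add: w mult_dvd_mono mult.commute)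
qed

text \<open>Split off minimal polynomials one at a time. Each divides \<open>X^M - 1\<close> and has
  positive degree, so at most \<open>degree f\<close> factors occur.\<close>

lemma dvd_unity_poly_power:
  fixes f :: "'a::{finite,field} poly"
  assumes "f \<noteq> 0" "\<And>x. ev f x = 0 \<Longrightarrow> x ^ M = 1"
  shows "f dvd unity_poly M ^ degree f"
  using assms
proof (induction "degree f" arbitrary: f rule: less_induct)
  case less
  show ?case
  proof (cases "degree f = 0")
    case True
    then have "is_unit f" using less.prems(1) by (simp add: is_unit_iff_degree)
    then show ?thesis by (rule dvd_trans) simp
  next
    case False
    then obtain x where x: "ev f x = 0" using ex_ev_root by blast
    then obtain h where h: "f = min_poly x * h" by (auto simp flip: min_poly_dvd_iff elim: dvdE)
    then have "h \<noteq> 0" using less.prems by auto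
    then have deg: "degree f = degree (min_poly x) + degree h" by (simp add: h degree_mult_eq)
    have "h dvd unity_poly M ^ degree h"
      using deg less.prems \<open>h \<noteq> 0\<close> by (intro less.hyps) (auto simp: h map_poly_to_ac_mult)
    moreover have "min_poly x dvd unity_poly M"
      using less.prems(2)[OF x] by (simp add: min_poly_dvd_iff ev_unity_poly del: map_poly_to_ac_unity_poly)
    ultimately have "min_poly x * h dvd unity_poly M * unity_poly M ^ degree h"
      by (rule mult_dvd_mono[rotated])
    also have "\<dots> = unity_poly M ^ (1 + degree h)" by simp
    also have "\<dots> dvd unity_poly M ^ degree f"
      unfolding deg using degree_min_poly_pos[of x] by (intro le_imp_power_dvd) linarith
    finally show ?thesis by (simp only: h)
  qed
qed

text \<open>The exponent \<open>degree f\<close> is at most \<open>p^t\<close>, and the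
  \<open>p^t\<close>-th power of \<open>X^M - 1\<close> is \<open>X^(M p^t) - 1\<close>.\<close>

lemma dvd_unity_poly_CHAR_power:
  fixes f :: "'a::{finite,field} poly"
  assumes "f \<noteq> 0" "\<And>x. ev f x = 0 \<Longrightarrow> x ^ M = 1" "degree f \<le> CHAR('a) ^ t"
  shows "f dvd unity_poly (M * CHAR('a) ^ t)"
proof -
  have "f dvd unity_poly M ^ degree f" using assms by (intro dvd_unity_poly_power)
  also have "\<dots> dvd unity_poly M ^ (CHAR('a) ^ t)" using assms(3) by (rule le_imp_power_dvd)
  also have "\<dots> = unity_poly (M * CHAR('a) ^ t)"
    by (rule unity_poly_power_CHAR) (rule prime_CHAR_finite)
  finally show ?thesis .
qed

context
  fixes f :: "'a::{finite,field} poly"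
  assumes f: "coeff f 0 \<noteq> 0"
begin

private lemma f_nonzero: "f \<noteq> 0"
  using f by auto

lemma root_power_of_degree_dvd:
  assumes "ev f x = 0" "degree (min_poly x) dvd i"
  shows "x ^ (CARD('a) ^ i - 1) = 1"
  using min_poly_dvd_unity_poly[OF ev_root_nonzero[OF f assms(1)] assms(2)]
  by (simp only: min_poly_dvd_iff ev_unity_poly)

lemma dvd_unity_poly_split:
  assumes "\<And>x. ev f x = 0 \<Longrightarrow> degree (min_poly x) = 1" "degree f \<le> CHAR('a) ^ t"
  shows "f dvd unity_poly ((CARD('a) - 1) * CHAR('a) ^ t)"
proof (rule dvd_unity_poly_CHAR_power[OF f_nonzero _ assms(2)])
  fix x assume "ev f x = 0"
  then show "x ^ (CARD('a) - 1) = 1" using root_power_of_degree_dvd[of x 1] assms(1)[of x] by simp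
qed

lemma degree_min_poly_le_degree:
  assumes "ev f x = 0"
  shows "degree (min_poly x) \<le> degree f"
  using assms f_nonzero by (intro dvd_imp_degree_le) (simp_all add: min_poly_dvd_iff)

lemma root_cofactor:
  assumes "ev f x = 0"
  obtains h where "f = min_poly x * h" "degree f = degree (min_poly x) + degree h"
    "coeff h 0 \<noteq> 0" "h \<noteq> 0"
proof -
  obtain h where h: "f = min_poly x * h" using assms by (auto simp flip: min_poly_dvd_iff elim: dvdE)
  then have "coeff h 0 \<noteq> 0" "h \<noteq> 0" using f by (auto simp: coeff_mult_0)
  moreover have "degree f = degree (min_poly x) + degree h"
    using h calculation by (simp add: degree_mult_eq)
  ultimately show ?thesis using that h by blast
qed

lemma dvd_unity_poly_irreducible:
  assumes "ev f x = 0" "degree (min_poly x) = degree f"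
  shows "f dvd unity_poly (CARD('a) ^ degree f - 1)"
proof -
  obtain h where h: "f = min_poly x * h" "degree f = degree (min_poly x) + degree h" "h \<noteq> 0"
    using root_cofactor[OF assms(1)] by metis
  then have "is_unit h" using assms(2) by (simp add: is_unit_iff_degree)
  then have "f dvd min_poly x" by (simp only: h(1) mult_unit_dvd_iff) simp
  also have "\<dots> dvd unity_poly (CARD('a) ^ degree f - 1)"
    using ev_root_nonzero[OF f assms(1)] assms(2) by (intro min_poly_dvd_unity_poly) auto
  finally show ?thesis .
qed

end

section \<open>Factorization patterns in degrees 1 to 4\<close>

lemma degree_1_min_poly:
  fixes f :: "'a::{finite,field} poly"
  assumes "coeff f 0 \<noteq> 0" "degree f = 1" "ev f x = 0"
  shows "degree (min_poly x) = 1"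
  using degree_min_poly_le_degree[OF assms(1,3)] assms(2) degree_min_poly_pos[of x] by linarith

lemma degree_1_dvd_unity_poly:
  fixes f :: "'a::{finite,field} poly"
  assumes "coeff f 0 \<noteq> 0" "degree f = 1"
  shows "f dvd unity_poly (CARD('a) - 1)"
  \<comment> \<open>The exponent \<open>t = 0\<close> suffices, since \<open>p^0 = 1\<close> covers
    degree 1.\<close>
  using dvd_unity_poly_split[OF assms(1) degree_1_min_poly[OF assms(1,2)], of 0] assms by simp

text \<open>As \<open>degree f > 2\<close>, \<open>min_poly x\<close> has degree at least 2 and
  cannot divide the linear cofactor. In degree 2 the square of a linear factor would be a
  counterexample.\<close>

lemma dvd_unity_poly_linear_cofactor:
  fixes f :: "'a::{finite,field} poly"
  assumes f: "coeff f 0 \<noteq> 0" "ev f x = 0" "degree f = Suc (degree (min_poly x))" "degree f > 2"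
  shows "f dvd unity_poly (CARD('a) ^ degree (min_poly x) - 1)"
proof -
  obtain h where h: "f = min_poly x * h" "degree f = degree (min_poly x) + degree h" "coeff h 0 \<noteq> 0" "h \<noteq> 0"
    using root_cofactor[OF f(1,2)] by metis
  have deg: "degree h = 1" using h f(3) by simp
  have "h dvd unity_poly (CARD('a) - 1)" using h(3) deg by (rule degree_1_dvd_unity_poly)
  also have "\<dots> dvd unity_poly (CARD('a) ^ degree (min_poly x) - 1)"
    by (intro unity_poly_dvd dvd_power_minus_1)
  finally have "h dvd unity_poly (CARD('a) ^ degree (min_poly x) - 1)" .
  moreover have "\<not> min_poly x dvd h"
    using dvd_imp_degree_le[of "min_poly x" h] deg f(3,4) h(4) by auto
  ultimately show ?thesis unfolding h(1)
    using ev_root_nonzero[OF f(1,2)] by (intro min_poly_mult_dvd min_poly_dvd_unity_poly) auto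
qed

text \<open>The quadratic cofactor has its roots in the field with \<open>q^2\<close> elements.
  Either \<open>min_poly x\<close> does not divide it, or \<open>f\<close> is a unit times the
  square of \<open>min_poly x\<close>, which the exponent \<open>p \<ge> 2\<close> absorbs.\<close>

lemma dvd_unity_poly_quadratic_factor:
  fixes f :: "'a::{finite,field} poly"
  assumes f: "coeff f 0 \<noteq> 0" "ev f x = 0" "degree f = 4" "degree (min_poly x) = 2"
  shows "f dvd unity_poly ((CARD('a) ^ 2 - 1) * CHAR('a))"
proof -
  let ?M = "CARD('a) ^ 2 - 1"
  obtain h where h: "f = min_poly x * h" "degree f = degree (min_poly x) + degree h" "coeff h 0 \<noteq> 0" "h \<noteq> 0"
    using root_cofactor[OF f(1,2)] by metis
  have deg: "degree h = 2" using h f by simp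
  have p: "2 \<le> CHAR('a) ^ 1" using prime_ge_2_nat[OF prime_CHAR_finite[where 'a='a]] by simp
  have root: "y ^ ?M = 1" if "ev h y = 0" for y
  proof (rule root_power_of_degree_dvd[OF h(3) that])
    have "degree (min_poly y) = 1 \<or> degree (min_poly y) = 2"
      using degree_min_poly_le_degree[OF h(3) that] deg degree_min_poly_pos[of y] by linarith
    then show "degree (min_poly y) dvd 2" by auto
  qed
  have hM: "h dvd unity_poly (?M * CHAR('a))"
    using dvd_unity_poly_CHAR_power[OF h(4) root, of 1] deg p by simp
  have gM: "min_poly x dvd unity_poly ?M"
    using ev_root_nonzero[OF f(1,2)] f(4) by (intro min_poly_dvd_unity_poly) auto
  show ?thesis
  proof (cases "min_poly x dvd h")
    case False
    have "min_poly x dvd unity_poly (?M * CHAR('a))"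
      using gM by (rule dvd_trans) (rule unity_poly_dvd, simp)
    then show ?thesis unfolding h(1) using hM False by (rule min_poly_mult_dvd)
  next
    case True
    then obtain c where c: "h = min_poly x * c" by (auto elim: dvdE)
    with h(4) have "c \<noteq> 0" by auto
    with c deg f(4) have "degree c = 0" by (simp add: degree_mult_eq)
    with \<open>c \<noteq> 0\<close> have "is_unit c" by (simp add: is_unit_iff_degree)
    then have "f dvd min_poly x ^ 2"
      by (simp only: h(1) c mult.assoc[symmetric] mult_unit_dvd_iff power2_eq_square) simp
    also have "\<dots> dvd unity_poly ?M ^ 2" by (rule dvd_power_same[OF gM])
    also have "\<dots> dvd unity_poly ?M ^ (CHAR('a) ^ 1)" using p by (rule le_imp_power_dvd)
    also have "\<dots> = unity_poly (?M * CHAR('a) ^ 1)" by (rule unity_poly_power_CHAR) (rule prime_CHAR_finite)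
    finally show ?thesis by simp
  qed
qed

lemma not_all_linearE:
  assumes "\<not> (\<forall>x. ev f x = 0 \<longrightarrow> degree (min_poly x) = 1)"
  obtains x where "ev f x = 0" "degree (min_poly x) \<ge> 2"
proof -
  obtain x where "ev f x = 0" "degree (min_poly x) \<noteq> 1" using assms by blast
  with degree_min_poly_pos[of x] that[of x] show ?thesis by linarith
qed

lemma degree_2_dvd_unity_poly:
  fixes f :: "'a::{finite,field} poly"
  assumes f: "coeff f 0 \<noteq> 0" "degree f = 2"
  shows "f dvd unity_poly (CARD('a) ^ 2 - 1) \<or> f dvd unity_poly ((CARD('a) - 1) * CHAR('a))"
proof (cases "\<forall>x. ev f x = 0 \<longrightarrow> degree (min_poly x) = 1")
  case True
  then show ?thesis
    using dvd_unity_poly_split[OF f(1), of 1] f(2) prime_ge_2_nat[OF prime_CHAR_finite[where 'a='a]] by simp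
next
  case False
  then obtain x where "ev f x = 0" "degree (min_poly x) \<ge> 2" by (rule not_all_linearE)
  then show ?thesis
    using dvd_unity_poly_irreducible[OF f(1), of x] degree_min_poly_le_degree[OF f(1), of x] f(2) by simp
qed

text \<open>A root outside the base field has degree 3, the irreducible case, or 2, with a linear
  cofactor. The exponent \<open>t\<close> stays free so that it can follow the
  characteristic.\<close>

lemma degree_3_dvd_unity_poly:
  fixes f :: "'a::{finite,field} poly"
  assumes f: "coeff f 0 \<noteq> 0" "degree f = 3" and t: "3 \<le> CHAR('a) ^ t"
  shows "f dvd unity_poly (CARD('a) ^ 3 - 1) \<or> f dvd unity_poly (CARD('a) ^ 2 - 1) \<or>
    f dvd unity_poly ((CARD('a) - 1) * CHAR('a) ^ t)"
proof (cases "\<forall>x. ev f x = 0 \<longrightarrow> degree (min_poly x) = 1")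
  case True
  then show ?thesis using dvd_unity_poly_split[OF f(1), of t] f(2) t by simp
next
  case False
  then obtain x where x: "ev f x = 0" "degree (min_poly x) \<ge> 2" by (rule not_all_linearE)
  then have "degree (min_poly x) = 2 \<or> degree (min_poly x) = 3"
    using degree_min_poly_le_degree[OF f(1), of x] f(2) by linarith
  then show ?thesis
    using dvd_unity_poly_irreducible[OF f(1) x(1)] dvd_unity_poly_linear_cofactor[OF f(1) x(1)] f(2) by auto
qed

text \<open>A root outside the base field has degree 4, the irreducible case, or 3 with a linear
  cofactor, or 2 with a quadratic one.\<close>

lemma degree_4_dvd_unity_poly:
  fixes f :: "'a::{finite,field} poly"
  assumes f: "coeff f 0 \<noteq> 0" "degree f = 4" and t: "4 \<le> CHAR('a) ^ t"
  shows "f dvd unity_poly (CARD('a) ^ 4 - 1) \<or> f dvd unity_poly (CARD('a) ^ 3 - 1) \<or>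
    f dvd unity_poly ((CARD('a) ^ 2 - 1) * CHAR('a)) \<or>
    f dvd unity_poly ((CARD('a) - 1) * CHAR('a) ^ t)"
proof (cases "\<forall>x. ev f x = 0 \<longrightarrow> degree (min_poly x) = 1")
  case True
  then show ?thesis using dvd_unity_poly_split[OF f(1), of t] f(2) t by simp
next
  case False
  then obtain x where x: "ev f x = 0" "degree (min_poly x) \<ge> 2" by (rule not_all_linearE)
  then have "degree (min_poly x) = 2 \<or> degree (min_poly x) = 3 \<or> degree (min_poly x) = 4"
    using degree_min_poly_le_degree[OF f(1), of x] f(2) by linarith
  then show ?thesis
    using dvd_unity_poly_irreducible[OF f(1) x(1)] dvd_unity_poly_linear_cofactor[OF f(1) x(1)]
      dvd_unity_poly_quadratic_factor[OF f(1) x(1)] f(2) by auto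
qed

section \<open>Divisors of \<open>M p\<close> and \<open>M p^2\<close>\<close>

lemma D_prime_mult:
  assumes "prime p"
  shows "D (M * p) \<subseteq> D M \<union> smul p (D M)"
proof
  fix d assume d: "d \<in> D (M * p)"
  show "d \<in> D M \<union> smul p (D M)"
  proof (cases "p dvd d")
    case True
    then obtain e where e: "d = p * e" by (auto elim: dvdE)
    with d assms have "e \<in> D M" by (auto simp: D_def mult.commute)
    then show ?thesis using e by (auto simp: smul_def)
  next
    case False
    then have "coprime d p" using prime_imp_coprime[OF assms] by (simp add: coprime_commute)
    then show ?thesis using d by (auto simp: D_def coprime_dvd_mult_left_iff)
  qed
qed

lemma D_prime_square_mult:
  assumes "prime p"
  shows "D (M * p ^ 2) \<subseteq> D M \<union> smul p (D M) \<union> smul (p ^ 2) (D M)"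
proof -
  have "D (M * p ^ 2) \<subseteq> D (M * p) \<union> smul p (D (M * p))"
    using D_prime_mult[OF assms, of "M * p"] by (simp add: power2_eq_square mult.assoc)
  moreover have "smul p (D (M * p)) \<subseteq> smul p (D M) \<union> smul (p ^ 2) (D M)"
    using D_prime_mult[OF assms, of M] by (force simp: smul_def power2_eq_square)
  ultimately show ?thesis using D_prime_mult[OF assms, of M] by blast
qed

lemma D_mono: "a dvd b \<Longrightarrow> D a \<subseteq> D b"
  by (auto simp: D_def intro: dvd_trans)

lemma smul_mono: "A \<subseteq> B \<Longrightarrow> smul c A \<subseteq> smul c B"
  by (auto simp: smul_def)

section \<open>Period sets\<close>

lemma D_subset_Pset:
  assumes "0 < i" "i \<le> k"
  shows "D (CARD('a::{finite,field}) ^ i - 1) \<subseteq> Pset k TYPE('a)"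
proof
  fix d assume "d \<in> D (CARD('a) ^ i - 1)"
  then show "d \<in> Pset k TYPE('a)"
    \<comment> \<open>Here \<open>r = 1\<close> and \<open>j = 0\<close>: the minimal polynomial
      itself.\<close>
    using CHAR_power_mult_in_Pset[of i d 1 k 0, where 'a='a] assms by (simp add: D_def)
qed

lemma smul_CHAR_D_subset_Pset:
  assumes "0 < i" "2 * i \<le> k"
  shows "smul CHAR('a) (D (CARD('a::{finite,field}) ^ i - 1)) \<subseteq> Pset k TYPE('a)"
proof
  fix n assume "n \<in> smul CHAR('a) (D (CARD('a) ^ i - 1))"
  then obtain d where "n = CHAR('a) * d" "d dvd CARD('a) ^ i - 1" by (auto simp: smul_def D_def)
  then show "n \<in> Pset k TYPE('a)"
    \<comment> \<open>Here \<open>r = 2\<close> and \<open>j = 1\<close>: squaring gains the factor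
      \<open>p\<close>, as \<open>1 < 2 \<le> p\<close>.\<close>
    using CHAR_power_mult_in_Pset[of i d 2 k 1, where 'a='a] assms
      prime_ge_2_nat[OF prime_CHAR_finite[where 'a='a]] by simp
qed

text \<open>The smallest exponent that gains \<open>p^2\<close> is \<open>p + 1\<close>; applied to
  a linear polynomial it gives degree \<open>p + 1\<close>, which must not exceed
  \<open>k\<close>.\<close>

lemma smul_CHAR_square_D_subset_Pset:
  assumes "CHAR('a) < k"
  shows "smul (CHAR('a) ^ 2) (D (CARD('a::{finite,field}) - 1)) \<subseteq> Pset k TYPE('a)"
proof
  fix n assume "n \<in> smul (CHAR('a) ^ 2) (D (CARD('a) - 1))"
  then obtain d where "n = CHAR('a) ^ 2 * d" "d dvd CARD('a) - 1" by (auto simp: smul_def D_def)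
  moreover have "Suc CHAR('a) \<le> CHAR('a) ^ 2"
  proof -
    have p: "2 \<le> CHAR('a)" by (rule prime_ge_2_nat[OF prime_CHAR_finite[where 'a='a]])
    then have "2 * CHAR('a) \<le> CHAR('a) ^ 2" unfolding power2_eq_square by (rule mult_le_mono1)
    with p show ?thesis by linarith
  qed
  ultimately show "n \<in> Pset k TYPE('a)"
    using CHAR_power_mult_in_Pset[of 1 d "Suc CHAR('a)" k 2, where 'a='a] assms by simp
qed

lemma card_power_minus_1_pos: "0 < i \<Longrightarrow> 0 < CARD('a::{finite,field}) ^ i - 1"
  using one_less_power[OF card_field_gt_1[where 'a='a], of i] by simp

lemma D_card_minus_1_subset:
  "D (CARD('a::{finite,field}) - 1) \<subseteq> D (CARD('a) ^ i - 1)"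
  by (rule D_mono[OF dvd_power_minus_1])

lemma Pset_subsetI:
  assumes "k > 0"
    and "\<And>f :: 'a::field poly. coeff f 0 \<noteq> 0 \<Longrightarrow> degree f = k \<Longrightarrow>
      \<exists>N>0. f dvd unity_poly N \<and> D N \<subseteq> S"
  shows "Pset k TYPE('a) \<subseteq> S"
proof
  fix n assume "n \<in> Pset k TYPE('a)"
  then obtain a :: "nat \<Rightarrow> 'a" where a: "n = period a" "lin_rec k a" by (auto simp: Pset_def)
  then obtain f where f: "degree f = k" "coeff f 0 \<noteq> 0" "\<And>n. rec_op f a n = 0"
    using lin_rec_iff_rec_op[OF assms(1)] by blast
  then obtain N where "N > 0" "f dvd unity_poly N" "D N \<subseteq> S" using assms(2) by blast
  then show "n \<in> S" using period_in_D[of f a N, OF f(3)] a(1) by blast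
qed

section \<open>The period sets for degrees 1 to 4\<close>

lemma Pset_1: "Pset 1 TYPE('a::{finite,field}) = D (CARD('a) - 1)"
proof (rule antisym)
  show "Pset 1 TYPE('a) \<subseteq> D (CARD('a) - 1)"
  proof (rule Pset_subsetI)
    fix f :: "'a poly" assume "coeff f 0 \<noteq> 0" "degree f = 1"
    then have "f dvd unity_poly (CARD('a) - 1)" by (rule degree_1_dvd_unity_poly)
    then show "\<exists>N>0. f dvd unity_poly N \<and> D N \<subseteq> D (CARD('a) - 1)"
      using card_field_gt_1[where 'a='a] by (intro exI[of _ "CARD('a) - 1"]) simp
  qed simp
  show "D (CARD('a) - 1) \<subseteq> Pset 1 TYPE('a)" using D_subset_Pset[of 1 1, where 'a='a] by simp
qed

lemma Pset_2:
  "Pset 2 TYPE('a::{finite,field}) = D (CARD('a) ^ 2 - 1) \<union> smul CHAR('a) (D (CARD('a) - 1))"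
    (is "_ = ?R")
proof (rule antisym)
  let ?q = "CARD('a)" and ?p = "CHAR('a)"
  have pos: "0 < ?q ^ 2 - 1" "0 < (?q - 1) * ?p"
    using card_power_minus_1_pos[of 1, where 'a='a] card_power_minus_1_pos[of 2, where 'a='a]
      prime_gt_0_nat[OF prime_CHAR_finite[where 'a='a]] by simp_all
  have sub: "D ((?q - 1) * ?p) \<subseteq> ?R" "D (?q ^ 2 - 1) \<subseteq> ?R"
    using D_prime_mult[OF prime_CHAR_finite[where 'a='a], of "?q - 1"]
      D_card_minus_1_subset[of 2, where 'a='a] by blast+
  show "Pset 2 TYPE('a) \<subseteq> ?R"
  proof (rule Pset_subsetI)
    fix f :: "'a poly" assume "coeff f 0 \<noteq> 0" "degree f = 2"
    from degree_2_dvd_unity_poly[OF this] pos sub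
    show "\<exists>N>0. f dvd unity_poly N \<and> D N \<subseteq> ?R" by blast
  qed simp
  show "?R \<subseteq> Pset 2 TYPE('a)"
    using D_subset_Pset[of 2 2, where 'a='a] smul_CHAR_D_subset_Pset[of 1 2, where 'a='a] by simp
qed

lemma Pset_3_subset:
  assumes "3 \<le> CHAR('a::{finite,field}) ^ t"
    and "D (CARD('a) ^ 3 - 1) \<union> D (CARD('a) ^ 2 - 1) \<union> D ((CARD('a) - 1) * CHAR('a) ^ t) \<subseteq> S"
  shows "Pset 3 TYPE('a) \<subseteq> S"
proof (rule Pset_subsetI)
  let ?q = "CARD('a)" and ?p = "CHAR('a)"
  have pos: "0 < ?q ^ 3 - 1" "0 < ?q ^ 2 - 1" "0 < (?q - 1) * ?p ^ t"
    using card_power_minus_1_pos[of 1, where 'a='a] card_power_minus_1_pos[of 2, where 'a='a]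
      card_power_minus_1_pos[of 3, where 'a='a]
      prime_gt_0_nat[OF prime_CHAR_finite[where 'a='a]] by simp_all
  fix f :: "'a poly" assume "coeff f 0 \<noteq> 0" "degree f = 3"
  from degree_3_dvd_unity_poly[OF this assms(1)] pos assms(2)
  show "\<exists>N>0. f dvd unity_poly N \<and> D N \<subseteq> S" by blast
qed simp

lemma Pset_4_subset:
  assumes "4 \<le> CHAR('a::{finite,field}) ^ t"
    and "D (CARD('a) ^ 4 - 1) \<union> D (CARD('a) ^ 3 - 1) \<union> D ((CARD('a) ^ 2 - 1) * CHAR('a)) \<union>
      D ((CARD('a) - 1) * CHAR('a) ^ t) \<subseteq> S"
  shows "Pset 4 TYPE('a) \<subseteq> S"
proof (rule Pset_subsetI)
  let ?q = "CARD('a)" and ?p = "CHAR('a)"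
  have pos: "0 < ?q ^ 4 - 1" "0 < ?q ^ 3 - 1" "0 < (?q ^ 2 - 1) * ?p" "0 < (?q - 1) * ?p ^ t"
    using card_power_minus_1_pos[of 1, where 'a='a] card_power_minus_1_pos[of 2, where 'a='a]
      card_power_minus_1_pos[of 3, where 'a='a] card_power_minus_1_pos[of 4, where 'a='a]
      prime_gt_0_nat[OF prime_CHAR_finite[where 'a='a]] by simp_all
  fix f :: "'a poly" assume "coeff f 0 \<noteq> 0" "degree f = 4"
  from degree_4_dvd_unity_poly[OF this assms(1)] pos assms(2)
  show "\<exists>N>0. f dvd unity_poly N \<and> D N \<subseteq> S" by blast
qed simp

lemma Pset_3_odd:
  assumes "CHAR('a::{finite,field}) \<ge> 3"
  shows "Pset 3 TYPE('a) = D (CARD('a) ^ 3 - 1) \<union> D (CARD('a) ^ 2 - 1) \<union>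
    smul CHAR('a) (D (CARD('a) - 1))"
proof (rule antisym)
  show "Pset 3 TYPE('a) \<subseteq> D (CARD('a) ^ 3 - 1) \<union> D (CARD('a) ^ 2 - 1) \<union>
      smul CHAR('a) (D (CARD('a) - 1))"
    \<comment> \<open>For \<open>p \<ge> 3\<close> the exponent \<open>t = 1\<close> covers a cube;
      divisors of \<open>q - 1\<close> already divide \<open>q^2 - 1\<close>.\<close>
    using D_prime_mult[OF prime_CHAR_finite[where 'a='a], of "CARD('a) - 1"]
      D_card_minus_1_subset[of 2, where 'a='a] assms
    by (intro Pset_3_subset[of 1]) auto
  show "D (CARD('a) ^ 3 - 1) \<union> D (CARD('a) ^ 2 - 1) \<union> smul CHAR('a) (D (CARD('a) - 1))
      \<subseteq> Pset 3 TYPE('a)"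
    using D_subset_Pset[of 3 3, where 'a='a] D_subset_Pset[of 2 3, where 'a='a]
      smul_CHAR_D_subset_Pset[of 1 3, where 'a='a] by simp
qed

lemma Pset_3_even:
  assumes "CHAR('a::{finite,field}) = 2"
  shows "Pset 3 TYPE('a) = D (CARD('a) ^ 3 - 1) \<union> D (CARD('a) ^ 2 - 1) \<union>
    setmul {2, 4} (D (CARD('a) - 1))"
proof -
  have eq: "setmul {2, 4} (D (CARD('a) - 1)) =
      smul CHAR('a) (D (CARD('a) - 1)) \<union> smul (CHAR('a) ^ 2) (D (CARD('a) - 1))"
    by (auto simp: assms setmul_def smul_def)
  show ?thesis unfolding eq
  proof (rule antisym)
    show "Pset 3 TYPE('a) \<subseteq> D (CARD('a) ^ 3 - 1) \<union> D (CARD('a) ^ 2 - 1) \<union>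
        (smul CHAR('a) (D (CARD('a) - 1)) \<union> smul (CHAR('a) ^ 2) (D (CARD('a) - 1)))"
    \<comment> \<open>For \<open>p = 2\<close> a cube needs \<open>t = 2\<close>, since
      \<open>2 < 3 \<le> 4\<close>.\<close>
    proof (rule Pset_3_subset[of 2])
      show "3 \<le> CHAR('a) ^ 2" by (simp add: assms)
    qed (use D_prime_square_mult[OF prime_CHAR_finite[where 'a='a], of "CARD('a) - 1"]
      D_card_minus_1_subset[of 2, where 'a='a] in blast)
    show "D (CARD('a) ^ 3 - 1) \<union> D (CARD('a) ^ 2 - 1) \<union>
        (smul CHAR('a) (D (CARD('a) - 1)) \<union> smul (CHAR('a) ^ 2) (D (CARD('a) - 1)))
        \<subseteq> Pset 3 TYPE('a)"
      using D_subset_Pset[of 3 3, where 'a='a] D_subset_Pset[of 2 3, where 'a='a]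
        smul_CHAR_D_subset_Pset[of 1 3, where 'a='a]
        smul_CHAR_square_D_subset_Pset[of 3, where 'a='a] assms by simp
  qed
qed

text \<open>Divisors of \<open>q^2 - 1\<close> divide \<open>q^4 - 1\<close>, so they form no
  separate part of the answer in degree 4.\<close>

lemma D_subset_quartic_union:
  "D ((CARD('a::{finite,field}) ^ 2 - 1) * CHAR('a)) \<subseteq>
     D (CARD('a) ^ 4 - 1) \<union> smul CHAR('a) (D (CARD('a) ^ 2 - 1))"
proof -
  have "CARD('a) ^ 2 - 1 dvd CARD('a) ^ 4 - 1"
    using dvd_power_minus_1[of "CARD('a) ^ 2" 2] by (simp flip: power_mult)
  then show ?thesis
    using D_prime_mult[OF prime_CHAR_finite[where 'a='a], of "CARD('a) ^ 2 - 1"] D_mono by blast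
qed

lemma smul_D_card_minus_1_subset:
  "smul c (D (CARD('a::{finite,field}) - 1)) \<subseteq> smul c (D (CARD('a) ^ 2 - 1))"
  by (rule smul_mono[OF D_card_minus_1_subset])

lemma Pset_4_large_CHAR:
  assumes "CHAR('a::{finite,field}) \<ge> 5"
  shows "Pset 4 TYPE('a) = D (CARD('a) ^ 4 - 1) \<union> D (CARD('a) ^ 3 - 1) \<union>
    smul CHAR('a) (D (CARD('a) ^ 2 - 1))"
proof (rule antisym)
  show "Pset 4 TYPE('a) \<subseteq> D (CARD('a) ^ 4 - 1) \<union> D (CARD('a) ^ 3 - 1) \<union>
      smul CHAR('a) (D (CARD('a) ^ 2 - 1))"
  \<comment> \<open>With \<open>t = 1\<close> the split case contributes \<open>p D(q - 1)\<close>,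
    which lies in \<open>p D(q^2 - 1)\<close>.\<close>
  proof (rule Pset_4_subset[of 1])
    show "4 \<le> CHAR('a) ^ 1" using assms by simp
  qed (use D_prime_mult[OF prime_CHAR_finite[where 'a='a], of "CARD('a) - 1"]
      D_card_minus_1_subset[of 4, where 'a='a] D_subset_quartic_union[where 'a='a]
      smul_D_card_minus_1_subset[of "CHAR('a)", where 'a='a] in \<open>unfold power_one_right, blast\<close>)
  show "D (CARD('a) ^ 4 - 1) \<union> D (CARD('a) ^ 3 - 1) \<union> smul CHAR('a) (D (CARD('a) ^ 2 - 1))
      \<subseteq> Pset 4 TYPE('a)"
    using D_subset_Pset[of 4 4, where 'a='a] D_subset_Pset[of 3 4, where 'a='a]
      smul_CHAR_D_subset_Pset[of 2 4, where 'a='a] by simp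
qed

lemma Pset_4_small_CHAR:
  assumes "CHAR('a::{finite,field}) = 2 \<or> CHAR('a) = 3"
  shows "Pset 4 TYPE('a) = D (CARD('a) ^ 4 - 1) \<union> D (CARD('a) ^ 3 - 1) \<union>
    smul CHAR('a) (D (CARD('a) ^ 2 - 1)) \<union> smul (CHAR('a) ^ 2) (D (CARD('a) - 1))"
proof (rule antisym)
  show "Pset 4 TYPE('a) \<subseteq> D (CARD('a) ^ 4 - 1) \<union> D (CARD('a) ^ 3 - 1) \<union>
      smul CHAR('a) (D (CARD('a) ^ 2 - 1)) \<union> smul (CHAR('a) ^ 2) (D (CARD('a) - 1))"
  \<comment> \<open>For both characteristics \<open>p < 4 \<le> p^2\<close>, so \<open>t = 2\<close>
    is the least exponent that covers a fourth power.\<close>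
  proof (rule Pset_4_subset[of 2])
    show "4 \<le> CHAR('a) ^ 2" using assms by auto
  qed (use D_prime_square_mult[OF prime_CHAR_finite[where 'a='a], of "CARD('a) - 1"]
      D_card_minus_1_subset[of 4, where 'a='a] D_subset_quartic_union[where 'a='a]
      smul_D_card_minus_1_subset[of "CHAR('a)", where 'a='a] in blast)
  show "D (CARD('a) ^ 4 - 1) \<union> D (CARD('a) ^ 3 - 1) \<union> smul CHAR('a) (D (CARD('a) ^ 2 - 1)) \<union>
      smul (CHAR('a) ^ 2) (D (CARD('a) - 1)) \<subseteq> Pset 4 TYPE('a)"
    using D_subset_Pset[of 4 4, where 'a='a] D_subset_Pset[of 3 4, where 'a='a]
      smul_CHAR_D_subset_Pset[of 2 4, where 'a='a]
      smul_CHAR_square_D_subset_Pset[of 4, where 'a='a] assms by auto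
qed

theorem theorem3p5:
  fixes p q :: nat
  assumes "p = semiring_char TYPE('a)" and "q = card (UNIV :: 'a set)"
  shows "Pset 1 TYPE('a::{finite,field}) = D (q - 1)
    \<and> Pset 2 TYPE('a) = D (q^2 - 1) \<union> smul p (D (q - 1))
    \<and> (p \<ge> 3 \<longrightarrow> Pset 3 TYPE('a) = D (q^3 - 1) \<union> D (q^2 - 1) \<union> smul p (D (q - 1)))
    \<and> (p = 2 \<longrightarrow> Pset 3 TYPE('a) = D (q^3 - 1) \<union> D (q^2 - 1) \<union> setmul {2, 4} (D (q - 1)))
    \<and> (p \<ge> 5 \<longrightarrow> Pset 4 TYPE('a) = D (q^4 - 1) \<union> D (q^3 - 1) \<union> smul p (D (q^2 - 1)))
    \<and> (p \<in> {2, 3} \<longrightarrow> Pset 4 TYPE('a) =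
          D (q^4 - 1) \<union> D (q^3 - 1) \<union> smul p (D (q^2 - 1)) \<union> smul (p^2) (D (q - 1)))"
  unfolding assms
  by (intro conjI impI Pset_1 Pset_2 Pset_3_odd Pset_3_even Pset_4_large_CHAR Pset_4_small_CHAR) auto

end
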